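(* Let $V$ be a finite-dimensional real vector space and let $W\subset GL(V)$ be a finite Coxeter group, i.e. a finite group generated by reflections of $V$. Then $\mathcal R_2W=\mathsf{Alt}(W)$.
   Context: For $g\in GL(V)$ of finite order, $V^{\langle g\rangle}$ is the subspace of vectors fixed by $g$. A reflection is a finite order element $g\in GL(V)$ with $\operatorname{codim}V^{\langle g\rangle}=1$; a rotation is a finite order element with $\operatorname{codim}V^{\langle g\rangle}=2$. $\mathcal R_2W$ is the subgroup of $W$ generated by the rotations contained in $W$. The alternating subgroup $\mathsf{Alt}(W)$ is the kernel of the determinant map $\det:W\to\mathbb R^\times$. *)

theory Defs
  imports
    Complex_Main
    "HOL-Algebra.Generated_Groups"
    "Jordan_Normal_Form.Determinant"
begin

section \<open>The general linear group of a real vector space\<close>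

definition GL :: "('v::real_vector \<Rightarrow> 'v) monoid" where
  "GL = \<lparr>carrier = {g. linear g \<and> bij g}, monoid.mult = (\<circ>), one = id\<rparr>"

lemma group_GL: "group (GL :: ('v::real_vector \<Rightarrow> 'v) monoid)"
proof (rule groupI)
  fix g :: "'v \<Rightarrow> 'v" assume "g \<in> carrier GL"
  then have g: "linear g" "bij g" by (auto simp: GL_def)
  have "linear (inv_into UNIV g)"
  proof (rule linearI)
    fix x y c
    show "inv_into UNIV g (x + y) = inv_into UNIV g x + inv_into UNIV g y"
      using g by (intro inv_f_eq) (auto simp: linear_add bij_def surj_f_inv_f)
    show "inv_into UNIV g (c *\<^sub>R x) = c *\<^sub>R inv_into UNIV g x"
      using g by (intro inv_f_eq) (auto simp: linear_scale bij_def surj_f_inv_f)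
  qed
  moreover have "inv_into UNIV g \<circ> g = id"
    using g by (simp add: bij_def)
  ultimately show "\<exists>y\<in>carrier GL. y \<otimes>\<^bsub>GL\<^esub> g = \<one>\<^bsub>GL\<^esub>"
    using g by (auto simp: GL_def bij_imp_bij_inv intro!: exI[of _ "inv_into UNIV g"])
qed (auto simp: GL_def linear_id bij_comp comp_assoc intro: linear_compose)


section \<open>Determinants of endomorphisms\<close>

definition ordered_basis :: "'v::real_vector list \<Rightarrow> bool" where
  "ordered_basis bs \<longleftrightarrow> distinct bs \<and> independent (set bs) \<and> span (set bs) = UNIV"

definition matrix_wrt :: "'v::real_vector list \<Rightarrow> 'v list \<Rightarrow> ('v \<Rightarrow> 'v) \<Rightarrow> real mat" where
  "matrix_wrt bs cs f =
     mat (length bs) (length cs) (\<lambda>(i, j). representation (set bs) (f (cs ! j)) (bs ! i))"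

text \<open>
  The chosen basis is immaterial by \<open>linear_det_eq\<close> below.  In infinite dimension there is no
  ordered basis and the value is unspecified.
\<close>

definition linear_det :: "('v::real_vector \<Rightarrow> 'v) \<Rightarrow> real" where
  "linear_det f = (let bs = (SOME bs. ordered_basis bs) in det (matrix_wrt bs bs f))"

lemma matrix_wrt_carrier [simp]: "matrix_wrt bs cs f \<in> carrier_mat (length bs) (length cs)"
  by (simp add: matrix_wrt_def)

lemma ordered_basis_ex:
  assumes "finite_dimensional_vector_space ((*\<^sub>R) :: real \<Rightarrow> 'v \<Rightarrow> 'v) B"
  shows "\<exists>bs :: 'v::real_vector list. ordered_basis bs"
proof -
  interpret V: finite_dimensional_vector_space "(*\<^sub>R) :: real \<Rightarrow> 'v \<Rightarrow> 'v" B by fact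
  obtain bs where "set bs = B" "distinct bs"
    using finite_distinct_list[OF V.finite_Basis] by blast
  then have "ordered_basis bs"
    using V.independent_Basis V.span_Basis
    unfolding ordered_basis_def dependent_raw_def span_raw_def by simp
  then show ?thesis ..
qed

lemma ordered_basis_length:
  assumes "ordered_basis (bs :: 'v::real_vector list)"
  shows "length bs = dim (UNIV :: 'v set)"
  using assms unfolding ordered_basis_def
  by (metis distinct_card real_vector.dim_eq_card_independent real_vector.dim_span)

lemma matrix_wrt_compose:
  assumes bs: "ordered_basis bs" and cs: "ordered_basis cs" and "linear f"
  shows "matrix_wrt bs ds (f \<circ> g) = matrix_wrt bs cs f * matrix_wrt cs ds g"
proof (rule eq_matI)
  fix i j
  assume "i < dim_row (matrix_wrt bs cs f * matrix_wrt cs ds g)"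
    and "j < dim_col (matrix_wrt bs cs f * matrix_wrt cs ds g)"
  then have ij: "i < length bs" "j < length ds" by (auto simp: matrix_wrt_def)
  let ?v = "g (ds ! j)"
  let ?r = "representation (set cs) ?v"
  note b = bs[unfolded ordered_basis_def] and c = cs[unfolded ordered_basis_def]
  have "f ?v = f (\<Sum>v\<in>set cs. ?r v *\<^sub>R v)"
    using real_vector.sum_representation_eq[of "set cs" ?v "set cs"] c by simp
  also have "\<dots> = (\<Sum>v\<in>set cs. ?r v *\<^sub>R f v)"
    using assms(3) by (simp add: linear_sum linear_scale)
  finally have "representation (set bs) (f ?v) (bs ! i) =
      (\<Sum>v\<in>set cs. ?r v * representation (set bs) (f v) (bs ! i))"
    using b by (simp add: real_vector.representation_sum real_vector.representation_scale)
  also have "\<dots> = (\<Sum>k<length cs. ?r (cs ! k) * representation (set bs) (f (cs ! k)) (bs ! i))"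
    by (rule sum.reindex_bij_betw[symmetric])
       (use bij_betw_nth[of cs "{..<length cs}" "set cs"] c in auto)
  finally show "matrix_wrt bs ds (f \<circ> g) $$ (i, j) =
      (matrix_wrt bs cs f * matrix_wrt cs ds g) $$ (i, j)"
    using ij by (simp add: matrix_wrt_def scalar_prod_def mult.commute lessThan_atLeast0)
qed (auto simp: matrix_wrt_def)

lemma matrix_wrt_id:
  assumes "ordered_basis bs"
  shows "matrix_wrt bs bs id = 1\<^sub>m (length bs)"
  using assms
  by (intro eq_matI)
     (auto simp: matrix_wrt_def ordered_basis_def real_vector.representation_basis nth_eq_iff_index_eq)

lemma linear_det_eq:
  assumes bs: "ordered_basis bs" and f: "linear f"
  shows "linear_det f = det (matrix_wrt bs bs f)"
proof -
  define cs where "cs = (SOME cs :: 'a list. ordered_basis cs)"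
  have cs: "ordered_basis cs" unfolding cs_def using bs by (rule someI)
  have len: "length cs = length bs"
    using ordered_basis_length[OF bs] ordered_basis_length[OF cs] by simp
  let ?P = "matrix_wrt cs bs id" and ?Q = "matrix_wrt bs cs id"
  have car: "?P \<in> carrier_mat (length bs) (length bs)" "?Q \<in> carrier_mat (length bs) (length bs)"
    "matrix_wrt bs bs f \<in> carrier_mat (length bs) (length bs)"
    using len by (metis matrix_wrt_carrier)+
  have id: "linear (id :: 'a \<Rightarrow> 'a)" by (rule linear_id)
  have "matrix_wrt cs cs f = ?P * matrix_wrt bs bs f * ?Q"
    using matrix_wrt_compose[OF cs bs id, of bs f] matrix_wrt_compose[OF cs bs f, of cs id] by simp
  moreover have "?P * ?Q = 1\<^sub>m (length bs)"
    using matrix_wrt_compose[OF cs bs id, of cs id] matrix_wrt_id[OF cs] len by simp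
  then have "det ?P * det ?Q = 1" using det_mult[OF car(1,2)] by simp
  moreover have "det (?P * matrix_wrt bs bs f * ?Q) = det ?P * det (matrix_wrt bs bs f) * det ?Q"
    by (simp only: det_mult[OF mult_carrier_mat[OF car(1,3)] car(2)] det_mult[OF car(1,3)])
  ultimately have "det (matrix_wrt cs cs f) = det (matrix_wrt bs bs f)"
    by (simp add: mult.left_commute mult.commute)
  then show ?thesis by (simp add: linear_det_def cs_def Let_def)
qed

lemma linear_det_compose:
  assumes "finite_dimensional_vector_space ((*\<^sub>R) :: real \<Rightarrow> 'v \<Rightarrow> 'v) B"
    and "linear f" "linear (g :: 'v::real_vector \<Rightarrow> 'v)"
  shows "linear_det (f \<circ> g) = linear_det f * linear_det g"
proof -
  obtain bs :: "'v list" where "ordered_basis bs" using ordered_basis_ex[OF assms(1)] ..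
  then show ?thesis using assms(2,3)
    by (simp add: linear_det_eq linear_compose matrix_wrt_compose[of bs bs f bs g]
        det_mult[OF matrix_wrt_carrier matrix_wrt_carrier])
qed


section \<open>Reflections, rotations and finite Coxeter groups\<close>

definition fixed_space :: "('v \<Rightarrow> 'v) \<Rightarrow> 'v set" where
  "fixed_space g = {v. g v = v}"

text \<open>The subtraction below does not truncate, since \<open>V\<close> will be finite-dimensional.\<close>

definition codim :: "'v::real_vector set \<Rightarrow> nat" where
  "codim U = dim (UNIV :: 'v set) - dim U"

definition finite_order :: "('v::real_vector \<Rightarrow> 'v) \<Rightarrow> bool" where
  "finite_order g \<longleftrightarrow> (\<exists>n::nat. n > 0 \<and> g [^]\<^bsub>GL\<^esub> n = \<one>\<^bsub>GL\<^esub>)"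

definition reflection :: "('v::real_vector \<Rightarrow> 'v) \<Rightarrow> bool" where
  "reflection g \<longleftrightarrow> g \<in> carrier GL \<and> finite_order g \<and> codim (fixed_space g) = 1"

definition rotation :: "('v::real_vector \<Rightarrow> 'v) \<Rightarrow> bool" where
  "rotation g \<longleftrightarrow> g \<in> carrier GL \<and> finite_order g \<and> codim (fixed_space g) = 2"

definition finite_coxeter_group :: "('v::real_vector \<Rightarrow> 'v) set \<Rightarrow> bool" where
  "finite_coxeter_group W \<longleftrightarrow> finite W \<and> (\<exists>S \<subseteq> {s. reflection s}. W = generate GL S)"

definition rotation_subgroup :: "('v::real_vector \<Rightarrow> 'v) set \<Rightarrow> ('v \<Rightarrow> 'v) set" where
  "rotation_subgroup W = generate GL {g \<in> W. rotation g}"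

definition real_units :: "real monoid" where
  "real_units = \<lparr>carrier = {x. x \<noteq> 0}, monoid.mult = (*), one = 1\<rparr>"

definition Alt :: "('v::real_vector \<Rightarrow> 'v) set \<Rightarrow> ('v \<Rightarrow> 'v) set" where
  "Alt W = kernel (GL\<lparr>carrier := W\<rparr>) real_units linear_det"

end

theory Submission
  imports Defs "HOL-Algebra.Multiplicative_Group"
begin

text \<open>
  Reflections have determinant \<open>-1\<close>, so an element of \<open>W\<close> of determinant \<open>1\<close> is a product of an
  even number of reflections.  A product of two reflections in \<open>W\<close> fixes a subspace of codimension at
  most \<open>2\<close>; codimension \<open>1\<close> would make it a reflection, of determinant \<open>-1\<close>, so it is a rotation
  or the identity.  Conversely, if a rotation \<open>g\<close> had determinant \<open>-1\<close>, the operator induced on the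
  two-dimensional quotient by its fixed space would have a positive eigenvalue.  Since \<open>g\<close> has finite
  order this eigenvalue is \<open>1\<close>, and an eigenvector lifts to a fixed vector outside the fixed space.
\<close>

section \<open>Composition, powers and fixed vectors in \<open>GL\<close>\<close>

lemma GL_simps [simp]:
  "x \<otimes>\<^bsub>GL\<^esub> y = x \<circ> y" "\<one>\<^bsub>GL\<^esub> = id" "g \<in> carrier GL \<longleftrightarrow> linear g \<and> bij g"
  by (simp_all add: GL_def)

lemma finite_order_iff: "finite_order g \<longleftrightarrow> (\<exists>n>0. g ^^ n = id)"
proof -
  have "g [^]\<^bsub>GL\<^esub> n = g ^^ n" for n :: nat
    by (induction n) (simp_all add: nat_pow_def GL_def funpow_Suc_right del: funpow.simps(2))
  then show ?thesis by (simp add: finite_order_def)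
qed

lemma subspace_fixed_space: "linear g \<Longrightarrow> subspace (fixed_space g)"
  by (simp add: fixed_space_def subspace_def linear_0 linear_add linear_scale)

section \<open>Determinants and fixed spaces\<close>

lemma det_mat_2: "det (mat 2 2 f :: 'a::comm_ring_1 mat) = f (0, 0) * f (1, 1) - f (0, 1) * f (1, 0)"
proof -
  let ?A = "mat 2 2 f"
  have "mat_delete ?A 0 0 = mat 1 1 (\<lambda>_. f (1, 1))" "mat_delete ?A 1 0 = mat 1 1 (\<lambda>_. f (0, 1))"
    by (auto intro!: eq_matI simp: mat_delete_def)
  moreover have "det (mat 1 1 h) = h (0, 0)" for h :: "nat \<times> nat \<Rightarrow> 'a"
    using det_single[of "mat 1 1 h"] by simp
  ultimately have "cofactor ?A 0 0 = f (1, 1)" "cofactor ?A 1 0 = - f (0, 1)"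
    by (simp_all add: cofactor_def)
  moreover have "det ?A = (\<Sum>i<2. ?A $$ (i, 0) * cofactor ?A i 0)"
    by (rule laplace_expansion_column) auto
  moreover have "{..<2} = {0, 1::nat}" by auto
  ultimately show ?thesis by (simp add: mult.commute)
qed

text \<open>A basis of \<open>U\<close> is extended to the whole space; \<open>bs\<close> witnesses
  finite dimension, so the extension is finite and can be listed.\<close>

lemma adapted_basis:
  assumes bs: "ordered_basis (bs :: 'v::real_vector list)" and U: "subspace (U :: 'v set)"
  obtains us vs where "ordered_basis (us @ vs)" "span (set us) = U" "length vs = codim U"
proof -
  obtain B where B: "B \<subseteq> U" "independent B" "U \<subseteq> span B" "card B = dim U"
    by (rule real_vector.basis_exists)
  let ?C = "extend_basis B"
  have C: "B \<subseteq> ?C" "independent ?C" "span ?C = UNIV"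
    using B by (simp_all add: real_vector.extend_basis_superset
        real_vector.independent_extend_basis)
  have fin: "finite ?C"
    using real_vector.independent_span_bound[of "set bs" ?C] C bs
    by (simp add: ordered_basis_def)
  obtain us where us: "set us = B" "distinct us"
    using finite_distinct_list[of B] fin C by (metis finite_subset)
  obtain vs where vs: "set vs = ?C - B" "distinct vs"
    using finite_distinct_list[of "?C - B"] fin by blast
  have *: "set (us @ vs) = ?C" using us vs C by auto
  then have basis: "ordered_basis (us @ vs)"
    unfolding ordered_basis_def using us vs C by auto
  have "length us = dim U" using us B by (metis distinct_card)
  then have "length vs = codim U"
    using ordered_basis_length[OF basis] by (simp add: codim_def)
  moreover have "span (set us) = U"
    using us B U by (simp add: real_vector.span_minimal subset_antisym)
  ultimately show ?thesis using basis that by blast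
qed

text \<open>When \<open>x\<close> is expanded in the full basis, only terms along \<open>us\<close>
  survive the subtraction. Coordinates along \<open>vs\<close> thus describe \<open>x\<close> modulo
  the span of \<open>us\<close>.\<close>

lemma ordered_basis_mod_span:
  assumes "ordered_basis (us @ vs)"
  shows "x - (\<Sum>i<length vs. representation (set (us @ vs)) x (vs ! i) *\<^sub>R vs ! i) \<in> span (set us)"
proof -
  let ?r = "representation (set (us @ vs)) x"
  have d: "distinct vs" "set us \<inter> set vs = {}" "independent (set (us @ vs))"
    "span (set (us @ vs)) = UNIV"
    using assms by (auto simp: ordered_basis_def)
  have "x = (\<Sum>v\<in>set us \<union> set vs. ?r v *\<^sub>R v)"
    using real_vector.sum_representation_eq[of "set (us @ vs)" x "set (us @ vs)"] d by simp
  also have "\<dots> = (\<Sum>v\<in>set us. ?r v *\<^sub>R v) + (\<Sum>v\<in>set vs. ?r v *\<^sub>R v)"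
    using d by (simp add: sum.union_disjoint)
  also have "(\<Sum>v\<in>set vs. ?r v *\<^sub>R v) = (\<Sum>i<length vs. ?r (vs ! i) *\<^sub>R vs ! i)"
    by (rule sum.reindex_bij_betw[symmetric])
       (use bij_betw_nth[of vs "{..<length vs}" "set vs"] d in auto)
  finally have "x - (\<Sum>i<length vs. ?r (vs ! i) *\<^sub>R vs ! i) = (\<Sum>v\<in>set us. ?r v *\<^sub>R v)"
    by (simp add: algebra_simps)
  also have "\<dots> \<in> span (set us)"
    by (intro real_vector.span_sum real_vector.span_scale real_vector.span_base)
  finally show ?thesis .
qed

text \<open>In this basis the matrix is block upper triangular with an identity block for
  \<open>us\<close>. The other diagonal block is the operator induced on the quotient by the span of
  \<open>us\<close>.\<close>

lemma linear_det_fixing: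
  assumes bs: "ordered_basis (us @ vs)" and f: "linear f"
    and fix_us: "\<And>u. u \<in> set us \<Longrightarrow> f u = u"
  shows "linear_det f = det (mat (length vs) (length vs)
    (\<lambda>(i, j). representation (set (us @ vs)) (f (vs ! j)) (vs ! i)))" (is "_ = det ?M")
proof -
  let ?m = "length us" and ?k = "length vs" and ?r = "representation (set (us @ vs))"
  let ?X = "mat ?m ?k (\<lambda>(i, j). ?r (f (vs ! j)) (us ! i))"
  have d: "distinct (us @ vs)" "independent (set (us @ vs))"
    using bs by (auto simp: ordered_basis_def)
  have rep: "?r ((us @ vs) ! j) ((us @ vs) ! i) = (if i = j then 1 else 0)"
    if "i < ?m + ?k" "j < ?m + ?k" for i j
    using that d real_vector.representation_basis[OF d(2), of "(us @ vs) ! j"]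
    by (metis length_append nth_eq_iff_index_eq nth_mem)
  have "matrix_wrt (us @ vs) (us @ vs) f = four_block_mat (1\<^sub>m ?m) ?X (0\<^sub>m ?k ?m) ?M"
  proof (rule eq_matI)
    fix i j
    assume "i < dim_row (four_block_mat (1\<^sub>m ?m) ?X (0\<^sub>m ?k ?m) ?M)"
      and "j < dim_col (four_block_mat (1\<^sub>m ?m) ?X (0\<^sub>m ?k ?m) ?M)"
    then have ij: "i < ?m + ?k" "j < ?m + ?k" by auto
    show "matrix_wrt (us @ vs) (us @ vs) f $$ (i, j) =
        four_block_mat (1\<^sub>m ?m) ?X (0\<^sub>m ?k ?m) ?M $$ (i, j)"
    proof (cases "j < ?m")
      case True
      then have "f ((us @ vs) ! j) = (us @ vs) ! j" by (simp add: nth_append fix_us)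
      then show ?thesis using rep[OF ij] ij True by (simp add: matrix_wrt_def)
    next
      case False
      then show ?thesis using ij by (simp add: matrix_wrt_def nth_append)
    qed
  qed (auto simp: matrix_wrt_def)
  moreover have "det (four_block_mat (1\<^sub>m ?m) ?X (0\<^sub>m ?k ?m) ?M) = det (1\<^sub>m ?m) * det ?M"
    by (rule det_four_block_mat_lower_left_zero) auto
  ultimately show ?thesis by (simp only: linear_det_eq[OF bs f] det_one mult_1)
qed

lemma linear_det_id:
  assumes "ordered_basis (bs :: 'v::real_vector list)"
  shows "linear_det (id :: 'v \<Rightarrow> 'v) = 1"
  using linear_det_eq[OF assms linear_id] matrix_wrt_id[OF assms] by simp

section \<open>Operators of finite order: eigenvalues and determinants\<close>

lemma power_eq_1_imp_real:
  assumes "(c::real) ^ n = 1" "n > 0"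
  shows "c = 1 \<or> c = -1"
proof -
  have "\<bar>c\<bar> ^ n = 1" using assms by (simp flip: power_abs)
  then have "\<bar>c\<bar> = 1" using assms power_eq_1_iff[of "\<bar>c\<bar>" n] by simp
  then show ?thesis by (simp add: abs_eq_iff')
qed

text \<open>A unipotent operator of finite order is trivial, which excludes the eigenvalue \<open>1\<close> on the
  quotient by the fixed space.\<close>

lemma eigenvalue_mod_fixed_space:
  assumes g: "linear g" "finite_order g" and w: "w \<notin> fixed_space g"
    and eig: "g w - c *\<^sub>R w \<in> fixed_space g"
  shows "c = -1"
proof -
  note sub = subspace_fixed_space[OF g(1)]
  obtain n where n: "n > 0" "g ^^ n = id" using g(2) finite_order_iff by blast
  define u where "u = g w - c *\<^sub>R w"
  have u: "g u = u" using eig by (simp add: u_def fixed_space_def)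
  have gw: "g w = c *\<^sub>R w + u" by (simp add: u_def)
  \<comment> \<open>Modulo the fixed space, \<open>w\<close> is an eigenvector of \<open>g\<close>
    with eigenvalue \<open>c\<close>. At \<open>k = n\<close> the power is the identity, and since
    \<open>w\<close> is not fixed, \<open>c ^ n = 1\<close>.\<close>
  have "(g ^^ k) w - c ^ k *\<^sub>R w \<in> fixed_space g" for k
  proof (induction k)
    case 0
    then show ?case using sub by (simp add: subspace_0)
  next
    case (Suc k)
    then have "g ((g ^^ k) w - c ^ k *\<^sub>R w) = (g ^^ k) w - c ^ k *\<^sub>R w"
      by (simp add: fixed_space_def)
    then have "(g ^^ Suc k) w - c ^ Suc k *\<^sub>R w = ((g ^^ k) w - c ^ k *\<^sub>R w) + c ^ k *\<^sub>R u"
      using g(1) by (simp add: linear_diff linear_scale gw algebra_simps)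
    then show ?case
      using Suc sub eig by (simp add: subspace_add subspace_scale u_def)
  qed
  from this[of n] have "(1 - c ^ n) *\<^sub>R w \<in> fixed_space g" using n by (simp add: algebra_simps)
  then have "inverse (1 - c ^ n) *\<^sub>R (1 - c ^ n) *\<^sub>R w \<in> fixed_space g"
    by (rule subspace_scale[OF sub])
  then have "c ^ n = 1" using w by (cases "c ^ n = 1") simp_all
  then have "c = 1 \<or> c = -1" using n power_eq_1_imp_real by blast
  moreover have "c \<noteq> 1"
  proof
    assume c: "c = 1"
    \<comment> \<open>Each application of \<open>g\<close> adds the same fixed vector
      \<open>u\<close>. Returning to \<open>w\<close> after \<open>n > 0\<close> steps forces
      \<open>u = 0\<close>, so \<open>w\<close> would be fixed.\<close>
    have "(g ^^ k) w = w + real k *\<^sub>R u" for k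
      by (induction k)
         (use g(1) in \<open>simp_all add: linear_add linear_scale gw u c algebra_simps\<close>)
    from this[of n] have "u = 0" using n by simp
    then show False using w gw c by (simp add: fixed_space_def)
  qed
  ultimately show ?thesis by simp
qed

text \<open>Modulo its fixed hyperplane, \<open>s\<close> acts by a scalar. This scalar is the
  determinant, and \<open>eigenvalue_mod_fixed_space\<close> applies to it.\<close>

lemma linear_det_reflection:
  assumes bs: "ordered_basis (bs :: 'v::real_vector list)" and s: "reflection (s :: 'v \<Rightarrow> 'v)"
  shows "linear_det s = -1"
proof -
  have lin: "linear s" and fin: "finite_order s" and cod: "codim (fixed_space s) = 1"
    using s by (auto simp: reflection_def)
  obtain us vs where uv: "ordered_basis (us @ vs)" "span (set us) = fixed_space s"
      "length vs = codim (fixed_space s)"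
    using adapted_basis[OF bs subspace_fixed_space[OF lin]] .
  then obtain a where vs: "vs = [a]" using cod by (auto simp: length_Suc_conv)
  let ?c = "representation (set (us @ vs)) (s a) a"
  have fix_us: "s u = u" if "u \<in> set us" for u
    using that uv(2) real_vector.span_base[of u "set us"] by (simp add: fixed_space_def)
  have "linear_det s = ?c"
    using linear_det_fixing[OF uv(1) lin fix_us] vs by (simp add: det_single[of _, simplified])
  moreover have "?c = -1"
  proof (rule eigenvalue_mod_fixed_space[OF lin fin])
    have "independent (insert a (set us))" "a \<notin> set us"
      using uv(1) vs by (auto simp: ordered_basis_def)
    then show "a \<notin> fixed_space s"
      using real_vector.independent_insert[of a "set us"] uv(2) by simp
    show "s a - ?c *\<^sub>R a \<in> fixed_space s"
      using ordered_basis_mod_span[OF uv(1), of "s a"] uv(2) vs by simp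
  qed
  ultimately show ?thesis by simp
qed

text \<open>By multiplicativity the determinant is a real root of unity.\<close>

lemma linear_det_finite_order:
  assumes fin: "finite_dimensional_vector_space ((*\<^sub>R) :: real \<Rightarrow> 'v \<Rightarrow> 'v) B"
    and g: "linear (g :: 'v::real_vector \<Rightarrow> 'v)" "finite_order g"
  shows "linear_det g = 1 \<or> linear_det g = -1"
proof -
  obtain bs :: "'v list" where bs: "ordered_basis bs" using ordered_basis_ex[OF fin] ..
  obtain n where n: "n > 0" "g ^^ n = id" using g(2) finite_order_iff by blast
  have "linear (g ^^ k) \<and> linear_det (g ^^ k) = linear_det g ^ k" for k
  proof (induction k)
    case 0
    show ?case using linear_det_id[OF bs] linear_id by (simp only: funpow.simps power_0)
  next
    case (Suc k)
    then have "linear (g \<circ> g ^^ k)" "linear_det (g \<circ> g ^^ k) = linear_det g * linear_det (g ^^ k)"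
      using linear_det_compose[OF fin g(1), of "g ^^ k"] linear_compose[OF _ g(1), of "g ^^ k"]
      by blast+
    then show ?case using Suc by (simp only: funpow.simps power_Suc)
  qed
  from this[of n] have "linear_det g ^ n = 1" using linear_det_id[OF bs] unfolding n(2) by simp
  then show ?thesis using n power_eq_1_imp_real by blast
qed

text \<open>The first row always annihilates \<open>(b, -a)\<close>, the second does because the
  determinant vanishes. A zero first row calls for \<open>(d, -c)\<close>, a zero matrix for
  \<open>(1, 0)\<close>.\<close>

lemma singular_2x2_kernel:
  fixes a b c d :: real
  assumes "a * d = b * c"
  obtains x y where "x \<noteq> 0 \<or> y \<noteq> 0" "a * x + b * y = 0" "c * x + d * y = 0"
proof (cases "a = 0 \<and> b = 0")
  case True
  show ?thesis
  proof (cases "c = 0 \<and> d = 0")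
    case True
    then show ?thesis using that[of 1 0] \<open>a = 0 \<and> b = 0\<close> by simp
  next
    case False
    then show ?thesis using that[of d "-c"] \<open>a = 0 \<and> b = 0\<close> by (auto simp: algebra_simps)
  qed
next
  case False
  then show ?thesis using that[of b "-a"] assms by (auto simp: algebra_simps)
qed

lemma linear_det_rotation:
  assumes fin: "finite_dimensional_vector_space ((*\<^sub>R) :: real \<Rightarrow> 'v \<Rightarrow> 'v) B"
    and g: "rotation (g :: 'v::real_vector \<Rightarrow> 'v)"
  shows "linear_det g = 1"
proof (rule ccontr)
  assume "linear_det g \<noteq> 1"
  have lin: "linear g" and ord: "finite_order g" and cod: "codim (fixed_space g) = 2"
    using g by (auto simp: rotation_def)
  have det: "linear_det g = -1"
    using linear_det_finite_order[OF fin lin ord] \<open>linear_det g \<noteq> 1\<close> by simp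
  note sub = subspace_fixed_space[OF lin]
  obtain bs :: "'v list" where bs: "ordered_basis bs" using ordered_basis_ex[OF fin] ..
  obtain us vs where uv: "ordered_basis (us @ vs)" "span (set us) = fixed_space g"
      "length vs = codim (fixed_space g)"
    using adapted_basis[OF bs sub] .
  then obtain v1 v2 where vs: "vs = [v1, v2]"
    using cod by (auto simp: length_Suc_conv numeral_2_eq_2)
  let ?r = "representation (set (us @ vs))"
  define a b c d where abcd: "a = ?r (g v1) v1" "b = ?r (g v2) v1" "c = ?r (g v1) v2" "d = ?r (g v2) v2"
  have fix_us: "g u = u" if "u \<in> set us" for u
    using that uv(2) real_vector.span_base[of u "set us"] by (simp add: fixed_space_def)
  have "linear_det g = a * d - b * c"
    using linear_det_fixing[OF uv(1) lin fix_us] vs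
    by (simp add: det_mat_2[unfolded numeral_2_eq_2] abcd)
  then have ad: "a * d - b * c = -1" using det by simp
  txt \<open>The positive root of the characteristic polynomial of the operator induced on
    the quotient by the fixed space\<close>
  define l where "l = (a + d + sqrt ((a + d)\<^sup>2 + 4)) / 2"
  \<comment> \<open>Determinant \<open>-1\<close> makes the discriminant exceed the squared trace,
    so the two roots have opposite signs and \<open>l\<close> is the positive one.\<close>
  have "\<bar>a + d\<bar> < sqrt ((a + d)\<^sup>2 + 4)"
    by (rule real_less_rsqrt) simp
  then have "l > 0" by (simp add: l_def)
  have "2 * l - (a + d) = sqrt ((a + d)\<^sup>2 + 4)" by (simp add: l_def field_simps)
  then have "(2 * l - (a + d))\<^sup>2 = (a + d)\<^sup>2 + 4" by simp
  \<comment> \<open>The induced matrix minus \<open>l\<close> is singular. The pair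
    \<open>(x, y)\<close> below is an eigenvector on the quotient, and \<open>w\<close> lifts
    it.\<close>
  then have "(a - l) * (d - l) = b * c"
    using ad by (simp add: power2_eq_square algebra_simps)
  then obtain x y where xy: "x \<noteq> 0 \<or> y \<noteq> 0" "(a - l) * x + b * y = 0" "c * x + (d - l) * y = 0"
    by (rule singular_2x2_kernel)
  define w where "w = x *\<^sub>R v1 + y *\<^sub>R v2"
  have g1: "g v1 - (a *\<^sub>R v1 + c *\<^sub>R v2) \<in> fixed_space g"
    using ordered_basis_mod_span[OF uv(1), of "g v1"] uv(2) vs
    by (simp add: abcd numeral_2_eq_2 algebra_simps)
  have g2: "g v2 - (b *\<^sub>R v1 + d *\<^sub>R v2) \<in> fixed_space g"
    using ordered_basis_mod_span[OF uv(1), of "g v2"] uv(2) vs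
    by (simp add: abcd numeral_2_eq_2 algebra_simps)
  have "l = -1"
  proof (rule eigenvalue_mod_fixed_space[OF lin ord])
    have ind: "independent (insert v1 (insert v2 (set us)))"
      and dist: "v1 \<notin> insert v2 (set us)" "v2 \<notin> set us"
      using uv(1) vs by (auto simp: ordered_basis_def insert_commute)
    have v2: "v2 \<notin> span (set us)" and v1: "v1 \<notin> span (insert v2 (set us))"
      using ind dist by (simp_all add: real_vector.independent_insert)
    show "w \<notin> fixed_space g"
    proof
      assume w: "w \<in> fixed_space g"
      then have sp: "w \<in> span (set us)" by (simp add: uv(2))
      \<comment> \<open>The order matters: \<open>v1\<close> avoids the span of \<open>v2\<close>
        and \<open>us\<close>, whereas \<open>v2\<close> is only known to avoid the span of
        \<open>us\<close>.\<close>
      have "x = 0"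
      proof (rule ccontr)
        assume x: "x \<noteq> 0"
        have "w - y *\<^sub>R v2 \<in> span (insert v2 (set us))"
          using sp by (meson insertI1 real_vector.span_base real_vector.span_diff
              real_vector.span_mono real_vector.span_scale subset_iff subset_insertI)
        then have "inverse x *\<^sub>R (w - y *\<^sub>R v2) \<in> span (insert v2 (set us))"
          by (rule real_vector.span_scale)
        then show False using v1 x by (simp add: w_def)
      qed
      moreover have "y = 0"
      proof (rule ccontr)
        assume y: "y \<noteq> 0"
        have "inverse y *\<^sub>R w \<in> span (set us)" using sp by (rule real_vector.span_scale)
        then show False using v2 y \<open>x = 0\<close> by (simp add: w_def)
      qed
      ultimately show False using xy(1) by simp
    qed
    \<comment> \<open>The bracketed differences are fixed vectors, and the last two coefficients
      vanish by the choice of \<open>x\<close> and \<open>y\<close>.\<close>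
    have "g w - l *\<^sub>R w = x *\<^sub>R (g v1 - (a *\<^sub>R v1 + c *\<^sub>R v2)) + y *\<^sub>R (g v2 - (b *\<^sub>R v1 + d *\<^sub>R v2))
        + ((a - l) * x + b * y) *\<^sub>R v1 + (c * x + (d - l) * y) *\<^sub>R v2"
      using lin by (simp add: w_def linear_add linear_scale algebra_simps)
    also have "\<dots> \<in> fixed_space g"
      using g1 g2 sub xy by (simp add: subspace_add subspace_scale)
    finally show "g w - l *\<^sub>R w \<in> fixed_space g" .
  qed
  then show False using \<open>l > 0\<close> by simp
qed

section \<open>Products of two reflections\<close>

text \<open>This is the dimension formula for \<open>S + T\<close>, together with the bound of the
  dimension of \<open>S + T\<close> by that of the whole space.\<close>

lemma codim_Int_le:
  assumes fin: "finite_dimensional_vector_space ((*\<^sub>R) :: real \<Rightarrow> 'v \<Rightarrow> 'v) B"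
    and "subspace S" "subspace (T :: 'v::real_vector set)"
  shows "codim (S \<inter> T) \<le> codim S + codim T"
proof -
  interpret V: finite_dimensional_vector_space "(*\<^sub>R) :: real \<Rightarrow> 'v \<Rightarrow> 'v" B by fact
  note raw = dim_raw_def[symmetric] subspace_raw_def[symmetric]
  have "dim {x + y |x y. x \<in> S \<and> y \<in> T} + dim (S \<inter> T) = dim S + dim T"
    using V.dim_sums_Int[unfolded raw] assms by blast
  moreover have "dim {x + y |x y. x \<in> S \<and> y \<in> T} \<le> dim (UNIV :: 'v set)"
    using V.dim_subset[unfolded raw] by blast
  ultimately show ?thesis by (simp add: codim_def)
qed

lemma codim_mono:
  assumes fin: "finite_dimensional_vector_space ((*\<^sub>R) :: real \<Rightarrow> 'v \<Rightarrow> 'v) B"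
    and "S \<subseteq> (T :: 'v::real_vector set)"
  shows "codim T \<le> codim S"
proof -
  interpret V: finite_dimensional_vector_space "(*\<^sub>R) :: real \<Rightarrow> 'v \<Rightarrow> 'v" B by fact
  show ?thesis
    using V.dim_subset[unfolded dim_raw_def[symmetric]] assms(2)
    by (simp add: codim_def diff_le_mono2)
qed

text \<open>A basis adapted to \<open>U\<close> has no vectors outside \<open>U\<close>.\<close>

lemma codim_eq_0:
  assumes bs: "ordered_basis (bs :: 'v::real_vector list)" and "subspace (U :: 'v set)" "codim U = 0"
  shows "U = UNIV"
  using adapted_basis[OF bs assms(2)] assms(3) by (metis append_Nil2 length_0_conv ordered_basis_def)

text \<open>Finite order is assumed because a product of two reflections can have infinite order; in
  a finite group it follows from Lagrange.\<close>

lemma reflection_mult: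
  assumes fin: "finite_dimensional_vector_space ((*\<^sub>R) :: real \<Rightarrow> 'v \<Rightarrow> 'v) B"
    and s: "reflection s" and t: "reflection (t :: 'v::real_vector \<Rightarrow> 'v)"
    and ord: "finite_order (s \<circ> t)"
  shows "s \<circ> t = id \<or> rotation (s \<circ> t)"
proof -
  obtain bs :: "'v list" where bs: "ordered_basis bs" using ordered_basis_ex[OF fin] ..
  have lin: "linear s" "linear t" "bij s" "bij t"
    and cod: "codim (fixed_space s) = 1" "codim (fixed_space t) = 1"
    using s t by (auto simp: reflection_def)
  have st: "s \<circ> t \<in> carrier GL" using lin by (simp add: linear_compose bij_comp)
  have "fixed_space s \<inter> fixed_space t \<subseteq> fixed_space (s \<circ> t)"
    by (auto simp: fixed_space_def)
  then have "codim (fixed_space (s \<circ> t)) \<le> 2"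
    using codim_Int_le[OF fin subspace_fixed_space[OF lin(1)] subspace_fixed_space[OF lin(2)]]
      codim_mono[OF fin] cod by (metis le_trans one_add_one)
  moreover have "codim (fixed_space (s \<circ> t)) \<noteq> 1"
  proof
    assume "codim (fixed_space (s \<circ> t)) = 1"
    then have "linear_det (s \<circ> t) = -1"
      using linear_det_reflection[OF bs] st ord by (simp add: reflection_def)
    then show False
      using linear_det_compose[OF fin lin(1,2)] linear_det_reflection[OF bs] s t by simp
  qed
  moreover have "s \<circ> t = id" if "codim (fixed_space (s \<circ> t)) = 0"
  proof -
    have "fixed_space (s \<circ> t) = UNIV"
      using codim_eq_0[OF bs subspace_fixed_space that] st by simp
    then have "(s \<circ> t) v = v" for v unfolding fixed_space_def by blast
    then show ?thesis by (simp add: fun_eq_iff)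
  qed
  ultimately show ?thesis using st ord unfolding rotation_def by
    (cases "codim (fixed_space (s \<circ> t))") auto
qed

text \<open>The inverse has the same fixed vectors and is killed by the same powers. This serves the
  \<open>inv\<close> case of induction over \<open>generate\<close>.\<close>

lemma reflection_m_inv:
  fixes s :: "'v::real_vector \<Rightarrow> 'v"
  assumes s: "reflection s"
  shows "reflection (inv\<^bsub>GL\<^esub> s)"
proof -
  interpret GL: group "GL :: ('v \<Rightarrow> 'v) monoid" by (rule group_GL)
  have c: "s \<in> carrier GL" using s by (simp add: reflection_def)
  let ?i = "inv\<^bsub>GL\<^esub> s"
  have "?i \<circ> s = id" "s \<circ> ?i = id" using GL.l_inv[OF c] GL.r_inv[OF c] by simp_all
  then have "fixed_space ?i = fixed_space s"
    unfolding fixed_space_def by (metis comp_apply id_apply)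
  moreover have "finite_order ?i"
    using s GL.nat_pow_inv[OF c] GL.inv_one unfolding reflection_def finite_order_def by metis
  ultimately show ?thesis
    using s GL.inv_closed[OF c] by (simp only: reflection_def)
qed

section \<open>The rotation subgroup\<close>

text \<open>By Lagrange, raising \<open>w\<close> to the order of \<open>W\<close> gives the
  identity.\<close>

lemma finite_subgroup_finite_order:
  assumes "subgroup W GL" "finite W" "w \<in> W"
  shows "finite_order w"
proof -
  interpret GL: group "GL :: ('a \<Rightarrow> 'a) monoid" by (rule group_GL)
  interpret W: group "GL\<lparr>carrier := W\<rparr>" by (rule GL.subgroup_imp_group[OF assms(1)])
  have "w [^]\<^bsub>GL\<^esub> Coset.order (GL\<lparr>carrier := W\<rparr>) = \<one>\<^bsub>GL\<^esub>"
    using W.pow_order_eq_1[of w] assms(3) GL.nat_pow_consistent by simp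
  moreover have "Coset.order (GL\<lparr>carrier := W\<rparr>) > 0"
    using assms by (auto simp: Coset.order_def card_gt_0_iff)
  ultimately show ?thesis unfolding finite_order_def by blast
qed

text \<open>Multiplicativity of the determinant gives closure. It then suffices to test generators
  when showing that the rotation subgroup lies in \<open>Alt W\<close>.\<close>

lemma subgroup_Alt:
  assumes fin: "finite_dimensional_vector_space ((*\<^sub>R) :: real \<Rightarrow> 'v \<Rightarrow> 'v) B"
    and W: "subgroup W (GL :: ('v::real_vector \<Rightarrow> 'v) monoid)"
  shows "subgroup (Alt W) GL"
proof -
  interpret GL: group "GL :: ('v \<Rightarrow> 'v) monoid" by (rule group_GL)
  obtain bs :: "'v list" where bs: "ordered_basis bs" using ordered_basis_ex[OF fin] ..
  have Alt: "Alt W = {w \<in> W. linear_det w = 1}"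
    by (simp add: Alt_def kernel_def real_units_def)
  have lin: "linear w" if "w \<in> W" for w using subgroup.mem_carrier[OF W that] by simp
  show ?thesis
  proof (rule GL.subgroupI)
    show "Alt W \<subseteq> carrier GL" using subgroup.subset[OF W] Alt by blast
    show "Alt W \<noteq> {}"
      using subgroup.one_closed[OF W] linear_det_id[OF bs] by (auto simp: Alt)
    fix g assume "g \<in> Alt W"
    then have g: "g \<in> W" "linear_det g = 1" by (simp_all add: Alt)
    have i: "inv\<^bsub>GL\<^esub> g \<in> W" by (rule subgroup.m_inv_closed[OF W g(1)])
    have "linear_det (inv\<^bsub>GL\<^esub> g \<circ> g) = 1"
      using GL.l_inv[OF subgroup.mem_carrier[OF W g(1)]] linear_det_id[OF bs] by simp
    then show "inv\<^bsub>GL\<^esub> g \<in> Alt W"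
      using linear_det_compose[OF fin lin[OF i] lin[OF g(1)]] g i by (simp add: Alt)
    fix h assume "h \<in> Alt W"
    then show "g \<otimes>\<^bsub>GL\<^esub> h \<in> Alt W"
      using g subgroup.m_closed[OF W, of g h] lin linear_det_compose[OF fin, of g h]
      by (simp add: Alt)
  qed
qed

theorem proposition4p3:
  fixes B :: "'v::real_vector set" and W :: "('v \<Rightarrow> 'v) set"
  assumes "finite_dimensional_vector_space ((*\<^sub>R) :: real \<Rightarrow> 'v \<Rightarrow> 'v) B"
    and "finite_coxeter_group W"
  shows "rotation_subgroup W = Alt W"
proof -
  note fin = assms(1)
  interpret GL: group "GL :: ('v \<Rightarrow> 'v) monoid" by (rule group_GL)
  obtain bs :: "'v list" where bs: "ordered_basis bs" using ordered_basis_ex[OF fin] ..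
  obtain S where finW: "finite W" and S: "\<And>s. s \<in> S \<Longrightarrow> reflection s" and WS: "W = generate GL S"
    using assms(2) by (auto simp: finite_coxeter_group_def)
  have "S \<subseteq> carrier GL" using S unfolding reflection_def by blast
  then have W: "subgroup W GL" unfolding WS by (rule GL.generate_is_subgroup)
  have lin: "linear w" if "w \<in> W" for w using subgroup.mem_carrier[OF W that] by simp
  have Alt: "Alt W = {w \<in> W. linear_det w = 1}"
    by (simp add: Alt_def kernel_def real_units_def)
  let ?R = "rotation_subgroup W"
  have "{g \<in> W. rotation g} \<subseteq> carrier GL" using subgroup.subset[OF W] by blast
  then have R: "subgroup ?R GL"
    unfolding rotation_subgroup_def by (rule GL.generate_is_subgroup)
  have refl_mult: "s \<circ> t \<in> ?R" if "s \<in> W" "t \<in> W" "reflection s" "reflection t" for s t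
  proof -
    have st: "s \<circ> t \<in> W" using subgroup.m_closed[OF W that(1,2)] by simp
    show ?thesis
      using reflection_mult[OF fin that(3,4) finite_subgroup_finite_order[OF W finW st]]
        subgroup.one_closed[OF R] st
      by (auto simp: rotation_subgroup_def intro: generate.incl)
  qed
  \<comment> \<open>The determinant replaces the parity of a word in reflections. An odd
    \<open>k\<close> is recorded through its products with all reflections of \<open>W\<close>, so
    that any next reflection can be paired with the pending one.\<close>
  define P where "P k \<longleftrightarrow> k \<in> W \<and> (linear_det k = 1 \<and> k \<in> ?R \<or>
      linear_det k = -1 \<and> (\<forall>t\<in>W. reflection t \<longrightarrow> t \<circ> k \<in> ?R))" for k
  have step: "P (s \<circ> k)" if "s \<in> W" "reflection s" "P k" for s k
  proof -
    have k: "k \<in> W" using that by (simp add: P_def)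
    have sk: "s \<circ> k \<in> W" using subgroup.m_closed[OF W that(1) k] by simp
    have det: "linear_det (s \<circ> k) = - linear_det k"
      using linear_det_compose[OF fin lin[OF that(1)] lin[OF k]]
        linear_det_reflection[OF bs that(2)] by simp
    show ?thesis
    proof (cases "linear_det k = 1")
      case True
      then have "k \<in> ?R" using that by (simp add: P_def)
      \<comment> \<open>Regrouped as \<open>(t \<circ> s) \<circ> k\<close>, this is a product of
        two elements of \<open>?R\<close>.\<close>
      then have "t \<circ> (s \<circ> k) \<in> ?R" if "t \<in> W" "reflection t" for t
        using refl_mult[OF that(1) \<open>s \<in> W\<close> that(2) \<open>reflection s\<close>]
          subgroup.m_closed[OF R, of "t \<circ> s" k] by (simp add: comp_assoc)
      then show ?thesis using det sk True by (simp add: P_def)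
    next
      case False
      \<comment> \<open>Here \<open>k\<close> is odd, and its clause in \<open>P\<close> is
        instantiated with \<open>t = s\<close>.\<close>
      then show ?thesis using that det sk by (simp add: P_def)
    qed
  qed
  \<comment> \<open>Quantifying over \<open>k\<close> handles the product case \<open>eng\<close>:
    left multiplications that preserve \<open>P\<close> compose.\<close>
  have "\<forall>k. P k \<longrightarrow> P (h \<circ> k)" if "h \<in> generate GL S" for h
    using that
  proof induction
    case one
    then show ?case by simp
  next
    case (incl h)
    then have "h \<in> W" "reflection h" using S generate.incl[of h S GL] WS by simp_all
    then show ?case using step by blast
  next
    case (inv h)
    then have "inv\<^bsub>GL\<^esub> h \<in> W" "reflection (inv\<^bsub>GL\<^esub> h)"
      using reflection_m_inv[OF S] generate.inv[of h S GL] WS by simp_all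
    then show ?case using step by blast
  next
    case (eng h1 h2)
    then show ?case by (simp add: comp_assoc)
  qed
  moreover have "P id"
    using linear_det_id[OF bs] subgroup.one_closed[OF W] subgroup.one_closed[OF R]
    by (simp add: P_def)
  ultimately have "P h" if "h \<in> W" for h using that WS by (metis comp_id)
  \<comment> \<open>Determinant \<open>1\<close> rules out the odd alternative in
    \<open>P\<close>.\<close>
  then have "Alt W \<subseteq> ?R" unfolding Alt P_def by fastforce
  moreover have "?R \<subseteq> Alt W"
    unfolding rotation_subgroup_def
    by (rule GL.generate_subgroup_incl[OF _ subgroup_Alt[OF fin W]])
       (auto simp: Alt linear_det_rotation[OF fin])
  ultimately show ?thesis by blast
qed

end
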